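(* Let $A$ be an associative algebra over a field $\mathbb{K}$ and let $(r,s)$ be an associative Yang-Baxter pair in $A$. Write $r=\sum r^{[1]}\otimes r^{[2]}$, $s=\sum s^{[1]}\otimes s^{[2]}$ (summation indices suppressed), and define $$R,S:A\to A,\qquad R(a)=\sum r^{[1]}a\,r^{[2]},\qquad S(a)=\sum s^{[1]}a\,s^{[2]}.$$ Then $(A,R,S)$ is a Rota-Baxter system. Furthermore, if $f:A\to B$ is an algebra map and $(r^f,s^f)$, with $r^f=(f\otimes f)(r)$ and $s^f=(f\otimes f)(s)$, is the associative Yang-Baxter pair in $B$ induced by $f$, then $f$ is a morphism of Rota-Baxter systems from the system $(A,R,S)$, with $R(a)=\sum r^{[1]}a\,r^{[2]}$ and $S(a)=\sum s^{[1]}a\,s^{[2]}$ for all $a\in A$, associated to $(r,s)$ to the system $(B,R_B,S_B)$, with $R_B(b)=\sum f(r^{[1]})\,b\,f(r^{[2]})$ and $S_B(b)=\sum f(s^{[1]})\,b\,f(s^{[2]})$ for all $b\in B$, associated to $(r^f,s^f)$.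
   Context: Algebras are associative, not necessarily unital, over a field $\mathbb{K}$; $\otimes=\otimes_{\mathbb{K}}$. For $r=\sum_i a_i\otimes b_i\in A\otimes A$ put $r_{12}=r\otimes 1$, $r_{13}=\sum_i a_i\otimes 1\otimes b_i$, $r_{23}=1\otimes r$, where $1$ is the identity of $A$ if $A$ is unital, or the identity of the extended unital algebra $\mathbb{K}\oplus A$ otherwise. Products such as $r_{13}r_{12}$ are taken in the triple tensor product algebra. An associative Yang-Baxter pair in $A$ is a pair $r,s\in A\otimes A$ such that $$r_{13}r_{12}-r_{12}r_{23}+s_{23}r_{13}=0,\qquad s_{13}r_{12}-s_{12}s_{23}+s_{23}s_{13}=0.$$ A Rota-Baxter system is a triple $(A,R,S)$ consisting of an algebra $A$ and $\mathbb{K}$-linear operators $R,S:A\to A$ such that, for all $a,b\in A$, $R(a)R(b)=R(R(a)b+aS(b))$ and $S(a)S(b)=S(R(a)b+aS(b))$. A morphism of Rota-Baxter systems from $(A,R_A,S_A)$ to $(B,R_B,S_B)$ is an algebra map $f:A\to B$ with $f\circ R_A=R_B\circ f$ and $f\circ S_A=S_B\circ f$. *)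

theory Defs
  imports Complex_Main "HOL-Library.Poly_Mapping" "HOL-Library.Product_Plus"
begin

text \<open>
  An algebra over the field \<open>'k\<close> is a (not necessarily unital) ring type together with a
  scalar multiplication. As no type class can mention the scalar multiplication of an algebra
  over an arbitrary field, the scalar multiplication is always an explicit parameter.
\<close>

locale assoc_algebra = vector_space scale
  for scale :: "'k::field \<Rightarrow> 'a::ring \<Rightarrow> 'a" +
  assumes scale_mult_left: "scale c a * b = scale c (a * b)"
    and scale_mult_right: "a * scale c b = scale c (a * b)"

definition algebra_map ::
  "('k::field \<Rightarrow> 'a::ring \<Rightarrow> 'a) \<Rightarrow> ('k \<Rightarrow> 'b::ring \<Rightarrow> 'b) \<Rightarrow> ('a \<Rightarrow> 'b) \<Rightarrow> bool" where
  "algebra_map scaleA scaleB f \<longleftrightarrow>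
     Vector_Spaces.linear scaleA scaleB f \<and> (\<forall>a b. f (a * b) = f a * f b)"


subsection \<open>Rota-Baxter systems\<close>

definition rota_baxter_system ::
  "('k::field \<Rightarrow> 'a::ring \<Rightarrow> 'a) \<Rightarrow> ('a \<Rightarrow> 'a) \<Rightarrow> ('a \<Rightarrow> 'a) \<Rightarrow> bool" where
  "rota_baxter_system scale R S \<longleftrightarrow>
     assoc_algebra scale \<and>
     Vector_Spaces.linear scale scale R \<and> Vector_Spaces.linear scale scale S \<and>
     (\<forall>a b. R a * R b = R (R a * b + a * S b)) \<and>
     (\<forall>a b. S a * S b = S (R a * b + a * S b))"

definition rota_baxter_morphism ::
  "('k::field \<Rightarrow> 'a::ring \<Rightarrow> 'a) \<Rightarrow> ('a \<Rightarrow> 'a) \<Rightarrow> ('a \<Rightarrow> 'a) \<Rightarrow>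
   ('k \<Rightarrow> 'b::ring \<Rightarrow> 'b) \<Rightarrow> ('b \<Rightarrow> 'b) \<Rightarrow> ('b \<Rightarrow> 'b) \<Rightarrow> ('a \<Rightarrow> 'b) \<Rightarrow> bool" where
  "rota_baxter_morphism scaleA RA SA scaleB RB SB f \<longleftrightarrow>
     rota_baxter_system scaleA RA SA \<and> rota_baxter_system scaleB RB SB \<and>
     algebra_map scaleA scaleB f \<and> f \<circ> RA = RB \<circ> f \<and> f \<circ> SA = SB \<circ> f"


subsection \<open>Free vector spaces and their quotients\<close>

text \<open>\<open>'i \<Rightarrow>\<^sub>0 'k\<close> is the free vector space on \<open>'i\<close>.\<close>

definition free_scale :: "'k::field \<Rightarrow> ('i \<Rightarrow>\<^sub>0 'k) \<Rightarrow> ('i \<Rightarrow>\<^sub>0 'k)" where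
  "free_scale c x = Poly_Mapping.map ((*) c) x"

abbreviation free_gen :: "'i \<Rightarrow> ('i \<Rightarrow>\<^sub>0 'k::field)" where
  "free_gen i \<equiv> Poly_Mapping.single i 1"

definition free_lift :: "('i \<Rightarrow> ('j \<Rightarrow>\<^sub>0 'k::field)) \<Rightarrow> ('i \<Rightarrow>\<^sub>0 'k) \<Rightarrow> ('j \<Rightarrow>\<^sub>0 'k)" where
  "free_lift g x = (\<Sum>i\<in>Poly_Mapping.keys x. free_scale (Poly_Mapping.lookup x i) (g i))"

text \<open>
  Elements of a quotient space are cosets. \<open>quot_map N F\<close> and \<open>quot_map2 N F\<close> compute the
  (bi)linear map \<open>F\<close>, whose values are taken modulo \<open>N\<close>, on representatives of its arguments.
\<close>

definition coset :: "'v::ab_group_add set \<Rightarrow> 'v \<Rightarrow> 'v set" where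
  "coset N x = {x + n | n. n \<in> N}"

definition quot_map :: "'w::ab_group_add set \<Rightarrow> ('v \<Rightarrow> 'w) \<Rightarrow> 'v set \<Rightarrow> 'w set" where
  "quot_map N F T = {F x + n | x n. x \<in> T \<and> n \<in> N}"

definition quot_map2 ::
  "'w::ab_group_add set \<Rightarrow> ('u \<Rightarrow> 'v \<Rightarrow> 'w) \<Rightarrow> 'u set \<Rightarrow> 'v set \<Rightarrow> 'w set" where
  "quot_map2 N F T U = {F x y + n | x y n. x \<in> T \<and> y \<in> U \<and> n \<in> N}"


subsection \<open>The tensor product of an algebra with itself\<close>

text \<open>
  \<open>A \<otimes> A\<close> is the free vector space on \<open>A \<times> A\<close> modulo the bilinearity relations.
\<close>

definition tensor2_relations ::
  "('k::field \<Rightarrow> 'a::ab_group_add \<Rightarrow> 'a) \<Rightarrow> ('a \<times> 'a \<Rightarrow>\<^sub>0 'k) set" where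
  "tensor2_relations scale =
     {free_gen (a + a', b) - free_gen (a, b) - free_gen (a', b) | a a' b. True} \<union>
     {free_gen (a, b + b') - free_gen (a, b) - free_gen (a, b') | a b b'. True} \<union>
     {free_gen (scale c a, b) - free_scale c (free_gen (a, b)) | c a b. True} \<union>
     {free_gen (a, scale c b) - free_scale c (free_gen (a, b)) | c a b. True}"

definition tensor2_null ::
  "('k::field \<Rightarrow> 'a::ab_group_add \<Rightarrow> 'a) \<Rightarrow> ('a \<times> 'a \<Rightarrow>\<^sub>0 'k) set" where
  "tensor2_null scale = module.span free_scale (tensor2_relations scale)"

definition tensor2 ::
  "('k::field \<Rightarrow> 'a::ab_group_add \<Rightarrow> 'a) \<Rightarrow> ('a \<times> 'a \<Rightarrow>\<^sub>0 'k) set set" where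
  "tensor2 scale = range (coset (tensor2_null scale))"

text \<open>
  The tensor \<open>\<Sum>i<m. u i \<otimes> v i\<close>. Every element of \<open>A \<otimes> A\<close> has this form, as scalars can be
  absorbed into \<open>u\<close>.
\<close>

definition tensor_sum ::
  "('k::field \<Rightarrow> 'a::ab_group_add \<Rightarrow> 'a) \<Rightarrow> nat \<Rightarrow> (nat \<Rightarrow> 'a) \<Rightarrow> (nat \<Rightarrow> 'a) \<Rightarrow>
   ('a \<times> 'a \<Rightarrow>\<^sub>0 'k) set" where
  "tensor_sum scale m u v = coset (tensor2_null scale) (\<Sum>i<m. free_gen (u i, v i))"

text \<open>The map \<open>f \<otimes> f\<close>; \<open>scaleB\<close> belongs to the target of \<open>f\<close>.\<close>

definition tensor2_map ::
  "('k::field \<Rightarrow> 'b::ab_group_add \<Rightarrow> 'b) \<Rightarrow> ('a \<Rightarrow> 'b) \<Rightarrow>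
   ('a \<times> 'a \<Rightarrow>\<^sub>0 'k) set \<Rightarrow> ('b \<times> 'b \<Rightarrow>\<^sub>0 'k) set" where
  "tensor2_map scaleB f =
     quot_map (tensor2_null scaleB) (free_lift (\<lambda>(a, b). free_gen (f a, f b)))"

text \<open>
  The operator \<open>a \<mapsto> \<Sum> t\<^sup>[\<^sup>1\<^sup>] a t\<^sup>[\<^sup>2\<^sup>]\<close> associated with a tensor \<open>t\<close>: the common value of this sum
  for all ways of writing \<open>t\<close> as a sum of pure tensors.
\<close>

definition tensor_operator ::
  "('k::field \<Rightarrow> 'a::ring \<Rightarrow> 'a) \<Rightarrow> ('a \<times> 'a \<Rightarrow>\<^sub>0 'k) set \<Rightarrow> 'a \<Rightarrow> 'a" where
  "tensor_operator scale t a =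
     the_elem {(\<Sum>i<m. u i * a * v i) | m u v. t = tensor_sum scale m u v}"


subsection \<open>The triple tensor product algebra\<close>

text \<open>
  Here the multiplication is a parameter as well, because the construction is applied both to
  an algebra and to its extended unital algebra.
\<close>

definition tensor3_relations ::
  "('k::field \<Rightarrow> 'a::ab_group_add \<Rightarrow> 'a) \<Rightarrow> ('a \<times> 'a \<times> 'a \<Rightarrow>\<^sub>0 'k) set" where
  "tensor3_relations scale =
     {free_gen (a + a', b, c) - free_gen (a, b, c) - free_gen (a', b, c) | a a' b c. True} \<union>
     {free_gen (a, b + b', c) - free_gen (a, b, c) - free_gen (a, b', c) | a b b' c. True} \<union>
     {free_gen (a, b, c + c') - free_gen (a, b, c) - free_gen (a, b, c') | a b c c'. True} \<union>
     {free_gen (scale k a, b, c) - free_scale k (free_gen (a, b, c)) | k a b c. True} \<union>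
     {free_gen (a, scale k b, c) - free_scale k (free_gen (a, b, c)) | k a b c. True} \<union>
     {free_gen (a, b, scale k c) - free_scale k (free_gen (a, b, c)) | k a b c. True}"

definition tensor3_null ::
  "('k::field \<Rightarrow> 'a::ab_group_add \<Rightarrow> 'a) \<Rightarrow> ('a \<times> 'a \<times> 'a \<Rightarrow>\<^sub>0 'k) set" where
  "tensor3_null scale = module.span free_scale (tensor3_relations scale)"

definition tensor3_zero ::
  "('k::field \<Rightarrow> 'a::ab_group_add \<Rightarrow> 'a) \<Rightarrow> ('a \<times> 'a \<times> 'a \<Rightarrow>\<^sub>0 'k) set" where
  "tensor3_zero scale = coset (tensor3_null scale) 0"

definition tensor3_add ::
  "('k::field \<Rightarrow> 'a::ab_group_add \<Rightarrow> 'a) \<Rightarrow> ('a \<times> 'a \<times> 'a \<Rightarrow>\<^sub>0 'k) set \<Rightarrow>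
   ('a \<times> 'a \<times> 'a \<Rightarrow>\<^sub>0 'k) set \<Rightarrow> ('a \<times> 'a \<times> 'a \<Rightarrow>\<^sub>0 'k) set" where
  "tensor3_add scale = quot_map2 (tensor3_null scale) (+)"

definition tensor3_diff ::
  "('k::field \<Rightarrow> 'a::ab_group_add \<Rightarrow> 'a) \<Rightarrow> ('a \<times> 'a \<times> 'a \<Rightarrow>\<^sub>0 'k) set \<Rightarrow>
   ('a \<times> 'a \<times> 'a \<Rightarrow>\<^sub>0 'k) set \<Rightarrow> ('a \<times> 'a \<times> 'a \<Rightarrow>\<^sub>0 'k) set" where
  "tensor3_diff scale = quot_map2 (tensor3_null scale) (-)"

definition tensor3_mult ::
  "('k::field \<Rightarrow> 'a::ab_group_add \<Rightarrow> 'a) \<Rightarrow> ('a \<Rightarrow> 'a \<Rightarrow> 'a) \<Rightarrow>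
   ('a \<times> 'a \<times> 'a \<Rightarrow>\<^sub>0 'k) set \<Rightarrow> ('a \<times> 'a \<times> 'a \<Rightarrow>\<^sub>0 'k) set \<Rightarrow> ('a \<times> 'a \<times> 'a \<Rightarrow>\<^sub>0 'k) set" where
  "tensor3_mult scale mult =
     quot_map2 (tensor3_null scale)
       (\<lambda>x y. free_lift (\<lambda>(a, b, c). free_lift (\<lambda>(a', b', c').
          free_gen (mult a a', mult b b', mult c c')) y) x)"

text \<open>In the following, \<open>e\<close> is the identity element.\<close>

definition leg12 ::
  "('k::field \<Rightarrow> 'a::ab_group_add \<Rightarrow> 'a) \<Rightarrow> 'a \<Rightarrow> ('a \<times> 'a \<Rightarrow>\<^sub>0 'k) set \<Rightarrow>
   ('a \<times> 'a \<times> 'a \<Rightarrow>\<^sub>0 'k) set" where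
  "leg12 scale e = quot_map (tensor3_null scale) (free_lift (\<lambda>(a, b). free_gen (a, b, e)))"

definition leg13 ::
  "('k::field \<Rightarrow> 'a::ab_group_add \<Rightarrow> 'a) \<Rightarrow> 'a \<Rightarrow> ('a \<times> 'a \<Rightarrow>\<^sub>0 'k) set \<Rightarrow>
   ('a \<times> 'a \<times> 'a \<Rightarrow>\<^sub>0 'k) set" where
  "leg13 scale e = quot_map (tensor3_null scale) (free_lift (\<lambda>(a, b). free_gen (a, e, b)))"

definition leg23 ::
  "('k::field \<Rightarrow> 'a::ab_group_add \<Rightarrow> 'a) \<Rightarrow> 'a \<Rightarrow> ('a \<times> 'a \<Rightarrow>\<^sub>0 'k) set \<Rightarrow>
   ('a \<times> 'a \<times> 'a \<Rightarrow>\<^sub>0 'k) set" where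
  "leg23 scale e = quot_map (tensor3_null scale) (free_lift (\<lambda>(a, b). free_gen (e, a, b)))"


subsection \<open>Associative Yang-Baxter pairs\<close>

definition yang_baxter_equations ::
  "('k::field \<Rightarrow> 'a::ab_group_add \<Rightarrow> 'a) \<Rightarrow> ('a \<Rightarrow> 'a \<Rightarrow> 'a) \<Rightarrow> 'a \<Rightarrow>
   ('a \<times> 'a \<Rightarrow>\<^sub>0 'k) set \<Rightarrow> ('a \<times> 'a \<Rightarrow>\<^sub>0 'k) set \<Rightarrow> bool" where
  "yang_baxter_equations scale mult e r s \<longleftrightarrow>
     (let add = tensor3_add scale; diff = tensor3_diff scale; mul = tensor3_mult scale mult;
          r12 = leg12 scale e r; r13 = leg13 scale e r; r23 = leg23 scale e r;
          s12 = leg12 scale e s; s13 = leg13 scale e s; s23 = leg23 scale e s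
      in add (diff (mul r13 r12) (mul r12 r23)) (mul s23 r13) = tensor3_zero scale \<and>
         add (diff (mul s13 r12) (mul s12 s23)) (mul s23 s13) = tensor3_zero scale)"

definition is_identity :: "'a::ring \<Rightarrow> bool" where
  "is_identity e \<longleftrightarrow> (\<forall>a. e * a = a \<and> a * e = a)"

text \<open>
  The extended unital algebra \<open>\<bbbK> \<oplus> A\<close>, with identity \<open>(1, 0)\<close> and with \<open>A\<close> embedded by
  \<open>a \<mapsto> (0, a)\<close>.
\<close>

definition ext_scale ::
  "('k::field \<Rightarrow> 'a::ring \<Rightarrow> 'a) \<Rightarrow> 'k \<Rightarrow> 'k \<times> 'a \<Rightarrow> 'k \<times> 'a" where
  "ext_scale scale c x = (c * fst x, scale c (snd x))"

definition ext_mult ::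
  "('k::field \<Rightarrow> 'a::ring \<Rightarrow> 'a) \<Rightarrow> 'k \<times> 'a \<Rightarrow> 'k \<times> 'a \<Rightarrow> 'k \<times> 'a" where
  "ext_mult scale x y =
     (fst x * fst y, scale (fst x) (snd y) + scale (fst y) (snd x) + snd x * snd y)"

definition ext_embed :: "'a \<Rightarrow> 'k::field \<times> 'a" where
  "ext_embed a = (0, a)"

definition assoc_yang_baxter_pair ::
  "('k::field \<Rightarrow> 'a::ring \<Rightarrow> 'a) \<Rightarrow> ('a \<times> 'a \<Rightarrow>\<^sub>0 'k) set \<Rightarrow> ('a \<times> 'a \<Rightarrow>\<^sub>0 'k) set \<Rightarrow> bool" where
  "assoc_yang_baxter_pair scale r s \<longleftrightarrow>
     r \<in> tensor2 scale \<and> s \<in> tensor2 scale \<and>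
     (if \<exists>e::'a. is_identity e
      then yang_baxter_equations scale (*) (THE e. is_identity e) r s
      else yang_baxter_equations (ext_scale scale) (ext_mult scale) (1, 0)
             (tensor2_map (ext_scale scale) ext_embed r)
             (tensor2_map (ext_scale scale) ext_embed s))"

end

theory Submission
  imports Defs
begin

text \<open>
  Multiplying out, every Yang-Baxter equation has the form
  \<open>t\<^sub>1\<^sub>3 r\<^sub>1\<^sub>2 - t\<^sub>1\<^sub>2 t\<^sub>2\<^sub>3 + s\<^sub>2\<^sub>3 t\<^sub>1\<^sub>3 = 0\<close> with \<open>t = r\<close> or \<open>t = s\<close>, and the
  left-hand side is represented by an element that does not involve the identity. It lies in
  \<open>A \<otimes> A \<otimes> A\<close>, which embeds into the triple tensor product of \<open>\<bbbK> \<oplus> A\<close> because the projection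
  \<open>\<bbbK> \<oplus> A \<rightarrow> A\<close> is a linear retraction of the inclusion. So the equations hold in the extended
  algebra iff they hold in \<open>A \<otimes> A \<otimes> A\<close>; in this form they are preserved by every algebra map,
  unital or not, and applying \<open>x \<otimes> y \<otimes> z \<mapsto> x a y b z\<close> to them gives
  \<open>T(R(a) b) - T(a) T(b) + T(a S(b)) = 0\<close>.
\<close>

subsection \<open>Linear extension from free vector spaces\<close>

lemma lookup_free_scale [simp]:
  "Poly_Mapping.lookup (free_scale c x) i = c * Poly_Mapping.lookup x i"
  by (simp add: free_scale_def Poly_Mapping.map.rep_eq when_def)

interpretation free: vector_space "free_scale :: 'k::field \<Rightarrow> ('i \<Rightarrow>\<^sub>0 'k) \<Rightarrow> ('i \<Rightarrow>\<^sub>0 'k)"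
  by unfold_locales (auto intro!: poly_mapping_eqI simp: lookup_add algebra_simps)

text \<open>The target is any vector space, not only a free one as for \<open>free_lift\<close>:
  evaluating tensors in the algebra itself requires this.\<close>

definition lin_ext ::
  "('k::field \<Rightarrow> 'v::ab_group_add \<Rightarrow> 'v) \<Rightarrow> ('i \<Rightarrow> 'v) \<Rightarrow> ('i \<Rightarrow>\<^sub>0 'k) \<Rightarrow> 'v" where
  "lin_ext sc g x = (\<Sum>i\<in>Poly_Mapping.keys x. sc (Poly_Mapping.lookup x i) (g i))"

context vector_space
begin

text \<open>Indices outside the support carry coefficient 0; this puts \<open>x\<close>,
  \<open>y\<close> and \<open>x + y\<close> over one index set.\<close>

lemma lin_ext_superset:
  fixes x :: "'i \<Rightarrow>\<^sub>0 'a"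
  assumes "finite K" "Poly_Mapping.keys x \<subseteq> K"
  shows "lin_ext scale g x = (\<Sum>i\<in>K. scale (Poly_Mapping.lookup x i) (g i))"
  unfolding lin_ext_def using assms
  by (intro sum.mono_neutral_left) (auto simp: in_keys_iff)

lemma lin_ext_add: "lin_ext scale g (x + y) = lin_ext scale g x + lin_ext scale g y"
proof -
  let ?K = "Poly_Mapping.keys x \<union> Poly_Mapping.keys y"
  have K: "finite ?K" by simp
  show ?thesis
    using lin_ext_superset[OF K, of x g] lin_ext_superset[OF K, of y g]
      lin_ext_superset[OF K, of "x + y" g] keys_add[of x y]
    by (auto simp: lookup_add scale_left_distrib sum.distrib)
qed

lemma lin_ext_scale: "lin_ext scale g (free_scale c x) = scale c (lin_ext scale g x)"
proof -
  have "Poly_Mapping.keys (free_scale c x) \<subseteq> Poly_Mapping.keys x"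
    by (auto simp: in_keys_iff)
  then show ?thesis
    using lin_ext_superset[of "Poly_Mapping.keys x" "free_scale c x" g]
    by (simp add: lin_ext_def scale_sum_right)
qed

lemma lin_ext_0: "lin_ext scale g 0 = 0"
  by (simp add: lin_ext_def)

lemma lin_ext_diff: "lin_ext scale g (x - y) = lin_ext scale g x - lin_ext scale g y"
  by (metis lin_ext_add diff_add_cancel add_diff_cancel)

lemma lin_ext_sum: "lin_ext scale g (\<Sum>i\<in>I. x i) = (\<Sum>i\<in>I. lin_ext scale g (x i))"
  by (induction I rule: infinite_finite_induct) (simp_all add: lin_ext_0 lin_ext_add)

lemma lin_ext_gen [simp]: "lin_ext scale g (free_gen i) = g i"
  by (simp add: lin_ext_def)

lemmas lin_ext_simps = lin_ext_0 lin_ext_add lin_ext_diff lin_ext_scale lin_ext_sum lin_ext_gen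

text \<open>Linearity in the function being extended makes nested extensions bilinear, as used for
  the product of triple tensors.\<close>

lemma lin_ext_fun_add: "lin_ext scale (\<lambda>i. g i + h i) x = lin_ext scale g x + lin_ext scale h x"
  by (simp add: lin_ext_def scale_right_distrib sum.distrib)

lemma lin_ext_fun_diff: "lin_ext scale (\<lambda>i. g i - h i) x = lin_ext scale g x - lin_ext scale h x"
  by (simp add: lin_ext_def scale_right_diff_distrib sum_subtractf)

lemma lin_ext_fun_scale: "lin_ext scale (\<lambda>i. scale c (g i)) x = scale c (lin_ext scale g x)"
  by (simp add: lin_ext_def scale_sum_right mult.commute)

lemma lin_ext_in_subspace:
  assumes "subspace N" "\<And>i. g i \<in> N"
  shows "lin_ext scale g x \<in> N"
  unfolding lin_ext_def using assms by (intro subspace_sum subspace_scale) auto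

text \<open>The preimage of a subspace under a linear map is a subspace, so testing the spanning set
  suffices.\<close>

lemma lin_ext_span:
  assumes "subspace N" "\<And>x. x \<in> Q \<Longrightarrow> lin_ext scale g x \<in> N" "x \<in> free.span Q"
  shows "lin_ext scale g x \<in> N"
proof -
  have "free.subspace {x. lin_ext scale g x \<in> N}"
    using assms(1)
    by (auto simp: free.subspace_def lin_ext_simps subspace_0 subspace_add subspace_scale)
  then have "free.span Q \<subseteq> {x. lin_ext scale g x \<in> N}"
    by (intro free.span_minimal) (auto intro: assms(2))
  with assms(3) show ?thesis by blast
qed

text \<open>Universal property of the tensor square, modulo \<open>N\<close>: a null space for maps
  into another tensor product, \<open>{0}\<close> for maps into the algebra.\<close>

lemma lin_ext_tensor2_null:
  assumes "subspace N" "x \<in> tensor2_null sc"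
    and "\<And>a a' b. g (a + a', b) - g (a, b) - g (a', b) \<in> N"
    and "\<And>a b b'. g (a, b + b') - g (a, b) - g (a, b') \<in> N"
    and "\<And>c a b. g (sc c a, b) - scale c (g (a, b)) \<in> N"
    and "\<And>c a b. g (a, sc c b) - scale c (g (a, b)) \<in> N"
  shows "lin_ext scale g x \<in> N"
  using assms(1) _ assms(2)[unfolded tensor2_null_def]
  by (rule lin_ext_span)
    (use assms in \<open>auto simp: tensor2_relations_def lin_ext_simps\<close>)

lemma lin_ext_tensor3_null:
  assumes "subspace N" "x \<in> tensor3_null sc"
    and "\<And>a a' b c. g (a + a', b, c) - g (a, b, c) - g (a', b, c) \<in> N"
    and "\<And>a b b' c. g (a, b + b', c) - g (a, b, c) - g (a, b', c) \<in> N"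
    and "\<And>a b c c'. g (a, b, c + c') - g (a, b, c) - g (a, b, c') \<in> N"
    and "\<And>k a b c. g (sc k a, b, c) - scale k (g (a, b, c)) \<in> N"
    and "\<And>k a b c. g (a, sc k b, c) - scale k (g (a, b, c)) \<in> N"
    and "\<And>k a b c. g (a, b, sc k c) - scale k (g (a, b, c)) \<in> N"
  shows "lin_ext scale g x \<in> N"
  using assms(1) _ assms(2)[unfolded tensor3_null_def]
  by (rule lin_ext_span)
    (use assms in \<open>auto simp: tensor3_relations_def lin_ext_simps\<close>)

end

lemma free_lift_eq: "free_lift = lin_ext free_scale"
  by (intro ext) (simp add: free_lift_def lin_ext_def)


subsection \<open>Quotients\<close>

lemma coset_eq_iff:
  assumes "free.subspace N"
  shows "coset N x = coset N y \<longleftrightarrow> x - y \<in> N"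
proof
  assume "coset N x = coset N y"
  moreover have "x \<in> coset N x"
    using free.subspace_0[OF assms] by (force simp: coset_def)
  ultimately show "x - y \<in> N" by (auto simp: coset_def)
next
  assume xy: "x - y \<in> N"
  show "coset N x = coset N y"
  proof (intro equalityI subsetI)
    fix z assume "z \<in> coset N x"
    then have "z - x \<in> N" by (auto simp: coset_def)
    from free.subspace_add[OF assms this xy] have "z - y \<in> N" by simp
    then show "z \<in> coset N y" by (force simp: coset_def)
  next
    fix z assume "z \<in> coset N y"
    then have "z - y \<in> N" by (auto simp: coset_def)
    from free.subspace_diff[OF assms this xy] have "z - x \<in> N" by simp
    then show "z \<in> coset N x" by (force simp: coset_def)
  qed
qed

text \<open>Changing the representative moves the value of \<open>F\<close> only within
  \<open>N\<close>, so the values collected by \<open>quot_map\<close> fill a single coset.\<close>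

lemma quot_map_coset:
  assumes N: "free.subspace N" and M: "free.subspace M"
    and F: "\<And>x m. m \<in> M \<Longrightarrow> F (x + m) - F x \<in> N"
  shows "quot_map N F (coset M x) = coset N (F x)"
proof (intro equalityI subsetI)
  fix z assume "z \<in> quot_map N F (coset M x)"
  then obtain m n where "m \<in> M" "n \<in> N" and z: "z = F (x + m) + n"
    by (auto simp: quot_map_def coset_def)
  then have "(F (x + m) - F x) + n \<in> N"
    by (intro free.subspace_add[OF N] F)
  then have "z - F x \<in> N" by (simp add: z algebra_simps)
  then show "z \<in> coset N (F x)" by (force simp: coset_def)
next
  fix z assume "z \<in> coset N (F x)"
  moreover have "x \<in> coset M x"
    using free.subspace_0[OF M] by (force simp: coset_def)
  ultimately show "z \<in> quot_map N F (coset M x)"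
    unfolding quot_map_def coset_def[of N] by blast
qed

lemma quot_map2_coset:
  assumes N: "free.subspace N" and M: "free.subspace M" and M': "free.subspace M'"
    and F: "\<And>x y m. m \<in> M \<Longrightarrow> F (x + m) y - F x y \<in> N"
    and F': "\<And>x y m. m \<in> M' \<Longrightarrow> F x (y + m) - F x y \<in> N"
  shows "quot_map2 N F (coset M x) (coset M' y) = coset N (F x y)"
proof (intro equalityI subsetI)
  fix z assume "z \<in> quot_map2 N F (coset M x) (coset M' y)"
  then obtain m m' n where "m \<in> M" "m' \<in> M'" "n \<in> N" and z: "z = F (x + m) (y + m') + n"
    by (auto simp: quot_map2_def coset_def)
  \<comment> \<open>Change the representatives one at a time, passing through
    \<open>F x (y + m')\<close>.\<close>
  then have "(F (x + m) (y + m') - F x (y + m')) + (F x (y + m') - F x y) + n \<in> N"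
    by (intro free.subspace_add[OF N] F F')
  then have "z - F x y \<in> N" by (simp add: z algebra_simps)
  then show "z \<in> coset N (F x y)" by (force simp: coset_def)
next
  fix z assume "z \<in> coset N (F x y)"
  moreover have "x \<in> coset M x"
    using free.subspace_0[OF M] by (force simp: coset_def)
  moreover have "y \<in> coset M' y"
    using free.subspace_0[OF M'] by (force simp: coset_def)
  ultimately show "z \<in> quot_map2 N F (coset M x) (coset M' y)"
    unfolding quot_map2_def coset_def[of N] by blast
qed


subsection \<open>Tensor products\<close>

lemma subspace_tensor2_null: "free.subspace (tensor2_null sc)"
  by (simp add: tensor2_null_def)

lemma subspace_tensor3_null: "free.subspace (tensor3_null sc)"
  by (simp add: tensor3_null_def)

lemma tensor2_null_relations:
  "free_gen (a + a', b) - free_gen (a, b) - free_gen (a', b) \<in> tensor2_null sc"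
  "free_gen (a, b + b') - free_gen (a, b) - free_gen (a, b') \<in> tensor2_null sc"
  "free_gen (sc c a, b) - free_scale c (free_gen (a, b)) \<in> tensor2_null sc"
  "free_gen (a, sc c b) - free_scale c (free_gen (a, b)) \<in> tensor2_null sc"
  unfolding tensor2_null_def tensor2_relations_def by (rule free.span_base, blast)+

lemma tensor3_null_relations:
  "free_gen (a + a', b, c) - free_gen (a, b, c) - free_gen (a', b, c) \<in> tensor3_null sc"
  "free_gen (a, b + b', c) - free_gen (a, b, c) - free_gen (a, b', c) \<in> tensor3_null sc"
  "free_gen (a, b, c + c') - free_gen (a, b, c) - free_gen (a, b, c') \<in> tensor3_null sc"
  "free_gen (sc k a, b, c) - free_scale k (free_gen (a, b, c)) \<in> tensor3_null sc"
  "free_gen (a, sc k b, c) - free_scale k (free_gen (a, b, c)) \<in> tensor3_null sc"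
  "free_gen (a, b, sc k c) - free_scale k (free_gen (a, b, c)) \<in> tensor3_null sc"
  unfolding tensor3_null_def tensor3_relations_def by (rule free.span_base, fast)+

lemma tensor_sum_in_tensor2: "tensor_sum sc m u v \<in> tensor2 sc"
  by (simp add: tensor_sum_def tensor2_def)

text \<open>\<open>f\<close> sends each bilinearity relation to one of the same kind, so f \<otimes>
  f is well defined and acts summand by summand.\<close>

lemma tensor2_map_tensor_sum:
  assumes "Vector_Spaces.linear scA scB f"
  shows "tensor2_map scB f (tensor_sum scA m u v) = tensor_sum scB m (f \<circ> u) (f \<circ> v)"
proof -
  interpret f: Vector_Spaces.linear scA scB f by fact
  have "lin_ext free_scale (\<lambda>(a, b). free_gen (f a, f b)) x \<in> tensor2_null scB"
    if "x \<in> tensor2_null scA" for x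
    by (rule free.lin_ext_tensor2_null[OF subspace_tensor2_null that])
      (simp_all add: f.add f.scale tensor2_null_relations)
  then show ?thesis
    unfolding tensor2_map_def tensor_sum_def free_lift_eq
    by (subst quot_map_coset[OF subspace_tensor2_null subspace_tensor2_null])
      (simp_all add: free.lin_ext_simps)
qed

text \<open>The map x \<otimes> y \<mapsto> x a y is bilinear, so every presentation gives the same
  value and \<open>the_elem\<close> meets a singleton.\<close>

lemma tensor_operator_tensor_sum:
  assumes "assoc_algebra sc"
  shows "tensor_operator sc (tensor_sum sc m u v) a = (\<Sum>i<m. u i * a * v i)"
proof -
  interpret assoc_algebra sc by fact
  have "(\<Sum>i<n. p i * a * q i) = (\<Sum>i<m. u i * a * v i)"
    if eq: "tensor_sum sc m u v = tensor_sum sc n p q" for n p q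
  proof -
    have "(\<Sum>i<m. free_gen (u i, v i)) - (\<Sum>i<n. free_gen (p i, q i)) \<in> tensor2_null sc"
      using eq by (simp add: tensor_sum_def coset_eq_iff[OF subspace_tensor2_null])
    then have "lin_ext sc (\<lambda>(x, y). x * a * y)
        ((\<Sum>i<m. free_gen (u i, v i)) - (\<Sum>i<n. free_gen (p i, q i))) \<in> {0}"
      by (rule lin_ext_tensor2_null[rotated])
        (simp_all add: algebra_simps scale_mult_left scale_mult_right)
    then show ?thesis by (simp add: lin_ext_simps)
  qed
  then have "{(\<Sum>i<n. p i * a * q i) | n p q. tensor_sum sc m u v = tensor_sum sc n p q}
      = {\<Sum>i<m. u i * a * v i}" by blast
  then show ?thesis by (simp add: tensor_operator_def)
qed

text \<open>The map f \<otimes> f \<otimes> f on representatives.\<close>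

definition tensor3_ext :: "('a \<Rightarrow> 'b) \<Rightarrow> ('a \<times> 'a \<times> 'a \<Rightarrow>\<^sub>0 'k) \<Rightarrow> ('b \<times> 'b \<times> 'b \<Rightarrow>\<^sub>0 'k::field)" where
  "tensor3_ext f = lin_ext free_scale (\<lambda>(a, b, c). free_gen (f a, f b, f c))"

lemma tensor3_ext_null:
  assumes "Vector_Spaces.linear scA scB f" "x \<in> tensor3_null scA"
  shows "tensor3_ext f x \<in> tensor3_null scB"
proof -
  interpret f: Vector_Spaces.linear scA scB f by fact
  show ?thesis
    unfolding tensor3_ext_def
    by (rule free.lin_ext_tensor3_null[OF subspace_tensor3_null assms(2)])
      (simp_all add: f.add f.scale tensor3_null_relations)
qed

lemma tensor3_add_coset:
  "tensor3_add sc (coset (tensor3_null sc) x) (coset (tensor3_null sc) y) =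
     coset (tensor3_null sc) (x + y)"
  unfolding tensor3_add_def by (rule quot_map2_coset) (simp_all add: subspace_tensor3_null)

lemma tensor3_diff_coset:
  "tensor3_diff sc (coset (tensor3_null sc) x) (coset (tensor3_null sc) y) =
     coset (tensor3_null sc) (x - y)"
  unfolding tensor3_diff_def
  by (rule quot_map2_coset)
    (simp_all add: subspace_tensor3_null free.subspace_neg algebra_simps)

text \<open>Putting \<open>e\<close> into a fixed slot is bilinear in the other two slots, hence
  well defined on tensors.\<close>

lemma leg_tensor_sum:
  assumes "vector_space sc"
  shows "leg12 sc e (tensor_sum sc m u v) = coset (tensor3_null sc) (\<Sum>i<m. free_gen (u i, v i, e))"
    and "leg13 sc e (tensor_sum sc m u v) = coset (tensor3_null sc) (\<Sum>i<m. free_gen (u i, e, v i))"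
    and "leg23 sc e (tensor_sum sc m u v) = coset (tensor3_null sc) (\<Sum>i<m. free_gen (e, u i, v i))"
proof -
  have null: "lin_ext free_scale (\<lambda>(a, b). free_gen (a, b, e)) x \<in> tensor3_null sc"
    "lin_ext free_scale (\<lambda>(a, b). free_gen (a, e, b)) x \<in> tensor3_null sc"
    "lin_ext free_scale (\<lambda>(a, b). free_gen (e, a, b)) x \<in> tensor3_null sc"
    if "x \<in> tensor2_null sc" for x
    by (rule free.lin_ext_tensor2_null[OF subspace_tensor3_null that];
        simp add: tensor3_null_relations)+
  note [simp] = free.lin_ext_simps
  note quot = quot_map_coset[OF subspace_tensor3_null subspace_tensor2_null]
  show "leg12 sc e (tensor_sum sc m u v) = coset (tensor3_null sc) (\<Sum>i<m. free_gen (u i, v i, e))"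
    unfolding leg12_def tensor_sum_def free_lift_eq by (subst quot) (simp_all add: null)
  show "leg13 sc e (tensor_sum sc m u v) = coset (tensor3_null sc) (\<Sum>i<m. free_gen (u i, e, v i))"
    unfolding leg13_def tensor_sum_def free_lift_eq by (subst quot) (simp_all add: null)
  show "leg23 sc e (tensor_sum sc m u v) = coset (tensor3_null sc) (\<Sum>i<m. free_gen (e, u i, v i))"
    unfolding leg23_def tensor_sum_def free_lift_eq by (subst quot) (simp_all add: null)
qed


subsection \<open>Bilinear multiplications with identity\<close>

text \<open>
  The multiplication is a parameter because that of the extended algebra is not the type class
  multiplication of pairs.
\<close>

locale unital_mult = vector_space sc for sc :: "'k::field \<Rightarrow> 'a::ab_group_add \<Rightarrow> 'a" +
  fixes mult :: "'a \<Rightarrow> 'a \<Rightarrow> 'a" and e :: 'a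
  assumes add_left: "mult (a + a') b = mult a b + mult a' b"
    and add_right: "mult a (b + b') = mult a b + mult a b'"
    and scale_left: "mult (sc k a) b = sc k (mult a b)"
    and scale_right: "mult a (sc k b) = sc k (mult a b)"
    and unit_left [simp]: "mult e a = a"
    and unit_right [simp]: "mult a e = a"
begin

abbreviation "N3 \<equiv> tensor3_null sc"

text \<open>The product on representatives that \<open>tensor3_mult\<close> passes to the
  quotient.\<close>

definition mult3 ::
  "('a \<times> 'a \<times> 'a \<Rightarrow>\<^sub>0 'k) \<Rightarrow> ('a \<times> 'a \<times> 'a \<Rightarrow>\<^sub>0 'k) \<Rightarrow> ('a \<times> 'a \<times> 'a \<Rightarrow>\<^sub>0 'k)" where
  "mult3 x y = lin_ext free_scale (\<lambda>(a, b, c). lin_ext free_scale (\<lambda>(a', b', c').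
     free_gen (mult a a', mult b b', mult c c')) y) x"

lemma mult3_null_left:
  assumes "x \<in> N3"
  shows "mult3 x y \<in> N3"
  unfolding mult3_def
  \<comment> \<open>The inner extension is linear in its function, so each relation in
    \<open>x\<close> becomes the extension of a function whose values are relations between
    products, hence in \<open>N3\<close>.\<close>
  by (rule free.lin_ext_tensor3_null[OF subspace_tensor3_null assms];
      simp only: prod.case flip: free.lin_ext_fun_diff free.lin_ext_fun_scale;
      rule free.lin_ext_in_subspace[OF subspace_tensor3_null])
    (auto simp: add_left scale_left tensor3_null_relations)

lemma mult3_null_right:
  assumes "y \<in> N3"
  shows "mult3 x y \<in> N3"
proof -
  \<comment> \<open>Multiplying by a fixed generator on the left respects the relations in
    \<open>y\<close>.\<close>
  have "lin_ext free_scale (\<lambda>(a', b', c'). free_gen (mult a a', mult b b', mult c c')) y \<in> N3"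
    for a b c
    by (rule free.lin_ext_tensor3_null[OF subspace_tensor3_null assms])
      (simp_all add: add_right scale_right tensor3_null_relations)
  then show ?thesis
    unfolding mult3_def by (intro free.lin_ext_in_subspace[OF subspace_tensor3_null]) auto
qed

lemma mult3_add_left: "mult3 (x + x') y = mult3 x y + mult3 x' y"
  by (simp add: mult3_def free.lin_ext_simps)

lemma mult3_add_right: "mult3 x (y + y') = mult3 x y + mult3 x y'"
  by (simp add: mult3_def free.lin_ext_simps case_prod_unfold flip: free.lin_ext_fun_add)

lemma tensor3_mult_coset:
  "tensor3_mult sc mult (coset N3 x) (coset N3 y) = coset N3 (mult3 x y)"
proof -
  have "tensor3_mult sc mult = quot_map2 N3 mult3"
    unfolding tensor3_mult_def free_lift_eq by (simp add: mult3_def[abs_def])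
  then show ?thesis
    by (simp add: quot_map2_coset subspace_tensor3_null mult3_add_left mult3_add_right
        mult3_null_left mult3_null_right)
qed

end

text \<open>
  The element \<open>t\<^sub>1\<^sub>3 r\<^sub>1\<^sub>2 - t\<^sub>1\<^sub>2 t\<^sub>2\<^sub>3 + s\<^sub>2\<^sub>3 t\<^sub>1\<^sub>3\<close>, multiplied out, for
  \<open>r = \<Sum>i<m. r1 i \<otimes> r2 i\<close>, \<open>s = \<Sum>i<n. s1 i \<otimes> s2 i\<close> and \<open>t = \<Sum>i<l. t1 i \<otimes> t2 i\<close>.
\<close>

definition yb_element ::
  "('a \<Rightarrow> 'a \<Rightarrow> 'a) \<Rightarrow> nat \<Rightarrow> (nat \<Rightarrow> 'a) \<Rightarrow> (nat \<Rightarrow> 'a) \<Rightarrow> nat \<Rightarrow> (nat \<Rightarrow> 'a) \<Rightarrow> (nat \<Rightarrow> 'a) \<Rightarrow>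
   nat \<Rightarrow> (nat \<Rightarrow> 'a) \<Rightarrow> (nat \<Rightarrow> 'a) \<Rightarrow> ('a \<times> 'a \<times> 'a \<Rightarrow>\<^sub>0 'k::field)" where
  "yb_element mult m r1 r2 n s1 s2 l t1 t2 =
     (\<Sum>i<l. \<Sum>j<m. free_gen (mult (t1 i) (r1 j), r2 j, t2 i)) -
     (\<Sum>i<l. \<Sum>j<l. free_gen (t1 i, mult (t2 i) (t1 j), t2 j)) +
     (\<Sum>i<n. \<Sum>j<l. free_gen (t1 j, s1 i, mult (s2 i) (t2 j)))"

text \<open>Each slot holds a factor or a product of two, never the identity, so only
  multiplicativity enters; this covers \<open>ext_embed\<close>, which does not preserve
  units.\<close>

lemma tensor3_ext_yb_element:
  assumes "\<And>a b. f (multA a b) = multB (f a) (f b)"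
  shows "tensor3_ext f (yb_element multA m r1 r2 n s1 s2 l t1 t2) =
    yb_element multB m (f \<circ> r1) (f \<circ> r2) n (f \<circ> s1) (f \<circ> s2) l (f \<circ> t1) (f \<circ> t2)"
  by (simp add: tensor3_ext_def yb_element_def free.lin_ext_simps assms)

text \<open>The unit laws absorb \<open>e\<close> when legs are multiplied, for example (a \<otimes>
  e \<otimes> b)(c \<otimes> d \<otimes> e) = ac \<otimes> d \<otimes> b. The conjuncts are the
  cases t = r and t = s.\<close>

lemma (in unital_mult) yang_baxter_equations_iff:
  "yang_baxter_equations sc mult e (tensor_sum sc m r1 r2) (tensor_sum sc n s1 s2) \<longleftrightarrow>
     yb_element mult m r1 r2 n s1 s2 m r1 r2 \<in> N3 \<and>
     yb_element mult m r1 r2 n s1 s2 n s1 s2 \<in> N3"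
  by (simp add: yang_baxter_equations_def Let_def leg_tensor_sum[OF vector_space_axioms]
      tensor3_mult_coset tensor3_add_coset tensor3_diff_coset tensor3_zero_def
      coset_eq_iff subspace_tensor3_null mult3_def free.lin_ext_simps yb_element_def)


subsection \<open>Associative Yang-Baxter pairs\<close>

context assoc_algebra
begin

lemma unital_mult_self:
  assumes "is_identity e"
  shows "unital_mult scale (*) e"
  by unfold_locales
    (use assms in \<open>auto simp: is_identity_def algebra_simps scale_mult_left scale_mult_right\<close>)

lemma unital_mult_ext: "unital_mult (ext_scale scale) (ext_mult scale) (1, 0)"
  by unfold_locales
    (auto simp: ext_scale_def ext_mult_def algebra_simps scale_mult_left scale_mult_right)

lemma linear_ext_embed: "Vector_Spaces.linear scale (ext_scale scale) ext_embed"
proof -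
  interpret ext: unital_mult "ext_scale scale" "ext_mult scale" "(1, 0)"
    by (rule unital_mult_ext)
  show ?thesis
    by unfold_locales (auto simp: ext_embed_def ext_scale_def)
qed

lemma linear_ext_snd: "Vector_Spaces.linear (ext_scale scale) scale snd"
proof -
  interpret ext: unital_mult "ext_scale scale" "ext_mult scale" "(1, 0)"
    by (rule unital_mult_ext)
  show ?thesis
    by unfold_locales (auto simp: ext_scale_def)
qed

lemma yb_element_ext_null_iff:
  "yb_element (ext_mult scale) m (ext_embed \<circ> r1) (ext_embed \<circ> r2) n (ext_embed \<circ> s1)
     (ext_embed \<circ> s2) l (ext_embed \<circ> t1) (ext_embed \<circ> t2) \<in> tensor3_null (ext_scale scale) \<longleftrightarrow>
   yb_element (*) m r1 r2 n s1 s2 l t1 t2 \<in> tensor3_null scale"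
  (is "?x' \<in> _ \<longleftrightarrow> ?x \<in> _")
proof -
  have embed: "tensor3_ext ext_embed ?x = ?x'"
    by (rule tensor3_ext_yb_element) (simp add: ext_embed_def ext_mult_def)
  have snd: "tensor3_ext snd ?x' = ?x"
    \<comment> \<open>\<open>snd\<close> is linear but not multiplicative on the extended algebra;
      all entries here have first component 0, where it does preserve products.\<close>
    by (simp add: tensor3_ext_def yb_element_def free.lin_ext_simps ext_embed_def ext_mult_def)
  show ?thesis
    using tensor3_ext_null[OF linear_ext_embed, of ?x] tensor3_ext_null[OF linear_ext_snd, of ?x']
    unfolding embed snd by blast
qed

text \<open>The unital and the non-unital case get the same criterion, so pairs can be transported
  between algebras of different kinds.\<close>

lemma assoc_yang_baxter_pair_iff:
  "assoc_yang_baxter_pair scale (tensor_sum scale m r1 r2) (tensor_sum scale n s1 s2) \<longleftrightarrow>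
     yb_element (*) m r1 r2 n s1 s2 m r1 r2 \<in> tensor3_null scale \<and>
     yb_element (*) m r1 r2 n s1 s2 n s1 s2 \<in> tensor3_null scale"
proof (cases "\<exists>e::'a. is_identity e")
  case True
  then obtain e :: 'a where e: "is_identity e" by blast
  \<comment> \<open>Two identities agree: e' = e' e = e.\<close>
  moreover have "e' = e" if "is_identity e'" for e' :: 'a
    using e that unfolding is_identity_def by metis
  ultimately have "(THE e::'a. is_identity e) = e" by blast
  then show ?thesis
    using True unital_mult.yang_baxter_equations_iff[OF unital_mult_self[OF e]]
    by (simp add: assoc_yang_baxter_pair_def tensor_sum_in_tensor2)
next
  case False
  then show ?thesis
    by (simp add: assoc_yang_baxter_pair_def tensor_sum_in_tensor2
        tensor2_map_tensor_sum[OF linear_ext_embed]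
        unital_mult.yang_baxter_equations_iff[OF unital_mult_ext] yb_element_ext_null_iff)
qed

text \<open>The map x \<otimes> y \<otimes> z \<mapsto> x a y b z is trilinear, hence kills null
  elements. The choices \<open>T = R\<close> and \<open>T = S\<close> give the two Rota-Baxter
  identities.\<close>

lemma yb_element_null_operator:
  assumes "yb_element (*) m r1 r2 n s1 s2 l t1 t2 \<in> tensor3_null scale"
  defines "R \<equiv> \<lambda>a. \<Sum>i<m. r1 i * a * r2 i" and "S \<equiv> \<lambda>a. \<Sum>i<n. s1 i * a * s2 i"
    and "T \<equiv> \<lambda>a. \<Sum>i<l. t1 i * a * t2 i"
  shows "T a * T b = T (R a * b + a * S b)"
proof -
  have "lin_ext scale (\<lambda>(x, y, z). x * a * y * b * z) (yb_element (*) m r1 r2 n s1 s2 l t1 t2) \<in> {0}"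
    by (rule lin_ext_tensor3_null[OF _ assms(1)])
      (simp_all add: algebra_simps scale_mult_left scale_mult_right)
  then have "(\<Sum>i<l. \<Sum>j<m. t1 i * r1 j * a * r2 j * b * t2 i) -
      (\<Sum>i<l. \<Sum>j<l. t1 i * a * (t2 i * t1 j) * b * t2 j) +
      (\<Sum>i<n. \<Sum>j<l. t1 j * a * s1 i * b * (s2 i * t2 j)) = 0"
    by (simp add: yb_element_def lin_ext_simps)
  moreover have "(\<Sum>i<l. \<Sum>j<m. t1 i * r1 j * a * r2 j * b * t2 i) = T (R a * b)"
    by (simp add: T_def R_def sum_distrib_left sum_distrib_right mult.assoc)
  moreover have "(\<Sum>i<l. \<Sum>j<l. t1 i * a * (t2 i * t1 j) * b * t2 j) = T a * T b"
    by (simp add: T_def sum_product mult.assoc)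
  moreover have "(\<Sum>i<n. \<Sum>j<l. t1 j * a * s1 i * b * (s2 i * t2 j)) = T (a * S b)"
    \<comment> \<open>The sum over \<open>s\<close> is outermost here, whereas in
      \<open>T (a * S b)\<close> the sum over \<open>t\<close> is.\<close>
    by (subst sum.swap) (simp add: T_def S_def sum_distrib_left sum_distrib_right mult.assoc)
  moreover have "T (R a * b + a * S b) = T (R a * b) + T (a * S b)"
    by (simp add: T_def algebra_simps sum.distrib)
  ultimately show ?thesis by (simp add: algebra_simps)
qed

lemma linear_sandwich: "Vector_Spaces.linear scale scale (\<lambda>a. \<Sum>i<m. u i * a * v i)"
  by unfold_locales
    (simp_all add: algebra_simps sum.distrib scale_mult_left scale_mult_right scale_sum_right)

lemma rota_baxter_system_of_pair:
  assumes "assoc_yang_baxter_pair scale (tensor_sum scale m r1 r2) (tensor_sum scale n s1 s2)"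
  shows "rota_baxter_system scale (tensor_operator scale (tensor_sum scale m r1 r2))
    (tensor_operator scale (tensor_sum scale n s1 s2))"
proof -
  note eq = tensor_operator_tensor_sum[OF assoc_algebra_axioms]
  show ?thesis
    using assms unfolding assoc_yang_baxter_pair_iff rota_baxter_system_def eq[abs_def]
    by (auto intro: assoc_algebra_axioms linear_sandwich yb_element_null_operator)
qed

end

text \<open>The presentations of \<open>r\<close> and \<open>s\<close> are arbitrary, so the
  operator formulas hold for every way of writing the two tensors. That the induced tensors form a
  pair in the target algebra is proved as part of the conclusion.\<close>

theorem proposition3p4:
  fixes scaleA :: "'k::field \<Rightarrow> 'a::ring \<Rightarrow> 'a"
    and r s :: "('a \<times> 'a \<Rightarrow>\<^sub>0 'k) set"
    and m n :: nat
    and r1 r2 s1 s2 :: "nat \<Rightarrow> 'a"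
  assumes "assoc_algebra scaleA"
    and "assoc_yang_baxter_pair scaleA r s"
    and "r = tensor_sum scaleA m r1 r2"
    and "s = tensor_sum scaleA n s1 s2"
  shows "(\<forall>a. tensor_operator scaleA r a = (\<Sum>i<m. r1 i * a * r2 i)) \<and>
    (\<forall>a. tensor_operator scaleA s a = (\<Sum>i<n. s1 i * a * s2 i)) \<and>
    rota_baxter_system scaleA (tensor_operator scaleA r) (tensor_operator scaleA s) \<and>
    (\<forall>(scaleB :: 'k \<Rightarrow> 'b::ring \<Rightarrow> 'b) f.
       assoc_algebra scaleB \<longrightarrow> algebra_map scaleA scaleB f \<longrightarrow>
       (let rf = tensor2_map scaleB f r; sf = tensor2_map scaleB f s in
          assoc_yang_baxter_pair scaleB rf sf \<and>
          (\<forall>b. tensor_operator scaleB rf b = (\<Sum>i<m. f (r1 i) * b * f (r2 i))) \<and>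
          (\<forall>b. tensor_operator scaleB sf b = (\<Sum>i<n. f (s1 i) * b * f (s2 i))) \<and>
          rota_baxter_morphism
            scaleA (tensor_operator scaleA r) (tensor_operator scaleA s)
            scaleB (tensor_operator scaleB rf) (tensor_operator scaleB sf) f))"
proof -
  interpret A: assoc_algebra scaleA by fact
  note r = assms(3) and s = assms(4)
  have opA: "tensor_operator scaleA r a = (\<Sum>i<m. r1 i * a * r2 i)"
    "tensor_operator scaleA s a = (\<Sum>i<n. s1 i * a * s2 i)" for a
    unfolding r s by (rule tensor_operator_tensor_sum[OF assms(1)])+
  have pair: "assoc_yang_baxter_pair scaleA (tensor_sum scaleA m r1 r2) (tensor_sum scaleA n s1 s2)"
    using assms(2) unfolding r s .
  have systemA: "rota_baxter_system scaleA (tensor_operator scaleA r) (tensor_operator scaleA s)"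
    unfolding r s by (rule A.rota_baxter_system_of_pair[OF pair])
  have "let rf = tensor2_map scaleB f r; sf = tensor2_map scaleB f s in
          assoc_yang_baxter_pair scaleB rf sf \<and>
          (\<forall>b. tensor_operator scaleB rf b = (\<Sum>i<m. f (r1 i) * b * f (r2 i))) \<and>
          (\<forall>b. tensor_operator scaleB sf b = (\<Sum>i<n. f (s1 i) * b * f (s2 i))) \<and>
          rota_baxter_morphism
            scaleA (tensor_operator scaleA r) (tensor_operator scaleA s)
            scaleB (tensor_operator scaleB rf) (tensor_operator scaleB sf) f"
    if B: "assoc_algebra scaleB" and f: "algebra_map scaleA scaleB f"
    for scaleB :: "'k \<Rightarrow> 'b::ring \<Rightarrow> 'b" and f
  proof -
    interpret B: assoc_algebra scaleB by fact
    have lin: "Vector_Spaces.linear scaleA scaleB f" and mult: "\<And>a b. f (a * b) = f a * f b"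
      using f by (auto simp: algebra_map_def)
    interpret f: Vector_Spaces.linear scaleA scaleB f by (rule lin)
    note opB = tensor_operator_tensor_sum[OF B]
    have rf: "tensor2_map scaleB f r = tensor_sum scaleB m (f \<circ> r1) (f \<circ> r2)"
      and sf: "tensor2_map scaleB f s = tensor_sum scaleB n (f \<circ> s1) (f \<circ> s2)"
      unfolding r s by (rule tensor2_map_tensor_sum[OF lin])+
    have pairB: "assoc_yang_baxter_pair scaleB (tensor_sum scaleB m (f \<circ> r1) (f \<circ> r2))
        (tensor_sum scaleB n (f \<circ> s1) (f \<circ> s2))"
      \<comment> \<open>Each Yang-Baxter element of the target is the image of that of the source
        under f \<otimes> f \<otimes> f, which preserves nullity.\<close>
      using pair tensor3_ext_null[OF lin]
      unfolding A.assoc_yang_baxter_pair_iff B.assoc_yang_baxter_pair_iff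
        tensor3_ext_yb_element[of f "(*)" "(*)", OF mult, symmetric]
      by blast
    have "rota_baxter_morphism
            scaleA (tensor_operator scaleA r) (tensor_operator scaleA s)
            scaleB (tensor_operator scaleB (tensor2_map scaleB f r))
            (tensor_operator scaleB (tensor2_map scaleB f s)) f"
      unfolding rota_baxter_morphism_def
    proof (intro conjI systemA f)
      show "rota_baxter_system scaleB (tensor_operator scaleB (tensor2_map scaleB f r))
          (tensor_operator scaleB (tensor2_map scaleB f s))"
        unfolding rf sf by (rule B.rota_baxter_system_of_pair[OF pairB])
    \<comment> \<open>Both commutation rules come from applying \<open>f\<close> to each summand:
      \<open>f (r1 i * a * r2 i) = f (r1 i) * f a * f (r2 i)\<close>, and likewise for
      \<open>s\<close>.\<close>
    qed (auto simp: fun_eq_iff rf sf opB opA f.sum mult)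
    then show ?thesis
      using pairB by (simp add: Let_def rf sf opB)
  qed
  then show ?thesis
    using systemA by (simp add: opA)
qed

end
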